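(* Let $G$ be a finite simple undirected graph with set of relevant cycles $\mathcal{C}_{\mathcal{R}}$. The polyhedron-interchangeability relation $\sim_{\mathtt{pi}}$ is an equivalence relation on $\mathcal{C}_{\mathcal{R}}$ (it is reflexive, symmetric and transitive).
   Context: Let $G=(V,E)$ be a finite simple undirected graph. A cycle is a set $C\subseteq E$ such that every vertex of $G$ has even degree in the subgraph with edge set $C$; $|C|$ denotes the number of edges of $C$. The cycles form a vector space (the cycle space) over $GF(2)$ with addition the symmetric difference $C_1\oplus C_2$. A cycle basis is a basis of this vector space. A minimum cycle basis (MCB) is a cycle basis $\mathcal{M}$ minimizing $\sum_{B\in\mathcal{M}}|B|$. The set of relevant cycles $\mathcal{C}_{\mathcal{R}}$ is the union of all MCBs. For $C_1,C_2\in\mathcal{C}_{\mathcal{R}}$, we write $C_1\sim_{\mathtt{pi}}C_2$ ($C_1$ is polyhedron-interchangeable for $C_2$) if there exists an MCB $\mathcal{M}_2$ with $C_2\in\mathcal{M}_2$ such that $(\mathcal{M}_2\setminus\{C_2\})\cup\{C_1\}$ is also an MCB. *)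

theory Defs
  imports "HOL-Number_Theory.Residues" "Jordan_Normal_Form.Missing_VectorSpace"
begin

definition finite_simple_graph :: "'v set \<Rightarrow> 'v set set \<Rightarrow> bool" where
  "finite_simple_graph V E \<longleftrightarrow> finite V \<and> (\<forall>e\<in>E. e \<subseteq> V \<and> card e = 2)"

definition cycles :: "'v set \<Rightarrow> 'v set set \<Rightarrow> 'v set set set" where
  "cycles V E = {C. C \<subseteq> E \<and> (\<forall>v\<in>V. even (card {e \<in> C. v \<in> e}))}"

abbreviation GF2 :: "int ring" where
  "GF2 \<equiv> residue_ring 2"

text \<open>The record type \<^typ>\<open>(int, 'b) module\<close> extends rings, so it also has fields for a
  multiplication and a unit; these play no role in a vector space.\<close>

definition cycle_space :: "'v set \<Rightarrow> 'v set set \<Rightarrow> (int, 'v set set) module" where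
  "cycle_space V E =
    \<lparr>carrier = cycles V E, monoid.mult = undefined, one = undefined,
     zero = {}, add = sym_diff, smult = (\<lambda>k C. if k = 0 then {} else C)\<rparr>"

abbreviation cycle_basis :: "'v set \<Rightarrow> 'v set set \<Rightarrow> 'v set set set \<Rightarrow> bool" where
  "cycle_basis V E \<equiv> vectorspace.basis GF2 (cycle_space V E)"

definition MCB :: "'v set \<Rightarrow> 'v set set \<Rightarrow> 'v set set set \<Rightarrow> bool" where
  "MCB V E M \<longleftrightarrow> is_arg_min (\<lambda>M. \<Sum>B\<in>M. card B) (cycle_basis V E) M"

definition relevant_cycles :: "'v set \<Rightarrow> 'v set set \<Rightarrow> 'v set set set" where
  "relevant_cycles V E = \<Union>{M. MCB V E M}"

definition pi_interchangeable :: "'v set \<Rightarrow> 'v set set \<Rightarrow> 'v set set \<Rightarrow> 'v set set \<Rightarrow> bool" where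
  "pi_interchangeable V E C\<^sub>1 C\<^sub>2 \<longleftrightarrow>
    (\<exists>M\<^sub>2. MCB V E M\<^sub>2 \<and> C\<^sub>2 \<in> M\<^sub>2 \<and> MCB V E ((M\<^sub>2 - {C\<^sub>2}) \<union> {C\<^sub>1}))"

lemma finite_simple_graph_finite_edges:
  assumes "finite_simple_graph V E"
  shows "finite E"
proof (rule finite_subset)
  show "E \<subseteq> Pow V" using assms by (auto simp: finite_simple_graph_def)
  show "finite (Pow V)" using assms by (simp add: finite_simple_graph_def)
qed

lemma sym_diff_cycles:
  assumes G: "finite_simple_graph V E" and C: "C \<in> cycles V E" and D: "D \<in> cycles V E"
  shows "sym_diff C D \<in> cycles V E"
proof -
  have fin: "finite C" "finite D"
    using C D finite_simple_graph_finite_edges[OF G] by (auto simp: cycles_def intro: finite_subset)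
  have "even (card {e \<in> sym_diff C D. v \<in> e})" if v: "v \<in> V" for v
  proof -
    define A B where "A = {e \<in> C. v \<in> e}" and "B = {e \<in> D. v \<in> e}"
    have f: "finite A" "finite B" using fin by (auto simp: A_def B_def)
    have ev: "even (card A)" "even (card B)" using C D v by (auto simp: cycles_def A_def B_def)
    have "{e \<in> sym_diff C D. v \<in> e} = (A - B) \<union> (B - A)" by (auto simp: A_def B_def)
    moreover have "card ((A - B) \<union> (B - A)) = card (A - B) + card (B - A)"
      using f by (intro card_Un_disjoint) auto
    moreover have "card A = card (A - B) + card (A \<inter> B)"
      using f by (metis Diff_Diff_Int Int_Diff_disjoint Int_commute Un_Diff_Int card_Un_disjoint
          finite_Diff finite_Int)
    moreover have "card B = card (B - A) + card (A \<inter> B)"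
      using f by (metis Int_Diff_disjoint Int_commute Un_Diff_Int card_Un_disjoint
          finite_Diff finite_Int)
    ultimately show ?thesis using ev by presburger
  qed
  then show ?thesis using C D by (auto simp: cycles_def)
qed

lemma vectorspace_cycle_space:
  assumes G: "finite_simple_graph V E"
  shows "vectorspace GF2 (cycle_space V E)"
proof -
  interpret F: residues_prime 2 GF2 by unfold_locales simp_all
  have car: "carrier (cycle_space V E) = cycles V E"
    and add: "\<And>C D. C \<oplus>\<^bsub>cycle_space V E\<^esub> D = sym_diff C D"
    and zero: "\<zero>\<^bsub>cycle_space V E\<^esub> = {}"
    and smult: "\<And>k C. k \<odot>\<^bsub>cycle_space V E\<^esub> C = (if k = 0 then {} else C)"
    by (simp_all add: cycle_space_def)
  have empty: "{} \<in> cycles V E" by (simp add: cycles_def)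
  have ag: "abelian_group (cycle_space V E)"
    by (rule abelian_groupI)
      (auto simp: car add zero empty intro: sym_diff_cycles[OF G])
  have bits: "carrier GF2 = {0, 1}"
    by (auto simp: residue_ring_def)
  have ops: "a \<oplus>\<^bsub>GF2\<^esub> b = (a + b) mod 2" "a \<otimes>\<^bsub>GF2\<^esub> b = (a * b) mod 2" "\<one>\<^bsub>GF2\<^esub> = 1" for a b
    by (simp_all add: residue_ring_def)
  have "module GF2 (cycle_space V E)"
    by (rule moduleI[OF F.cring ag])
      (auto simp: car add smult empty bits ops intro: sym_diff_cycles[OF G])
  then show ?thesis
    by (simp add: vectorspace_def F.is_field)
qed

end

theory Submission
  imports Defs
begin

text \<open>Minimum cycle bases inherit the symmetric exchange property of bases: by minimality of both
  bases, the two exchanged cycles have the same length. Interchangeability of \<open>x\<close> and \<open>y\<close> says that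
  both complete some common set \<open>H\<close> to a member of the family. Suppose \<open>H\<close> is completed by \<open>x\<close> and
  \<open>y\<close>, and \<open>K\<close> by \<open>y\<close> and \<open>z\<close>. Exchanging \<open>h \<in> H - K\<close> for \<open>k \<in> K - H\<close> between the bases
  \<open>H + y\<close> and \<open>K + y\<close>, either \<open>H - h + k\<close> can replace \<open>H\<close>, or \<open>K - k + h\<close> can replace \<open>K\<close>, or
  \<open>H - h + y\<close> and \<open>K - k + y\<close> form such a pair with \<open>h\<close> as the middle element. In each case
  \<open>|H - K|\<close> drops, and for \<open>H = K\<close> transitivity is clear.\<close>

section \<open>Set families with symmetric exchange\<close>

locale base_exchange =
  fixes \<B> :: "'a set set"
  assumes finite_base: "A \<in> \<B> \<Longrightarrow> finite A"
    and exchange: "\<lbrakk>A \<in> \<B>; B \<in> \<B>; a \<in> A - B\<rbrakk> \<Longrightarrow>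
      \<exists>b\<in>B - A. insert b (A - {a}) \<in> \<B> \<and> insert a (B - {b}) \<in> \<B>"
begin

text \<open>An element of \<open>B - A\<close> would have to be exchanged for an element of
  \<open>A - B\<close>, which is empty.\<close>

lemma base_antichain:
  assumes "A \<in> \<B>" "B \<in> \<B>" "A \<subseteq> B"
  shows "A = B"
  using exchange[OF assms(2,1)] assms(3) by blast

definition completes :: "'a set \<Rightarrow> 'a \<Rightarrow> bool" where
  "completes H x \<longleftrightarrow> x \<notin> H \<and> insert x H \<in> \<B>"

text \<open>When \<open>h\<close> leaves the base \<open>J + h + x\<close>, only \<open>k\<close> or
  \<open>y\<close> can come in from \<open>J + k + y\<close>. The last assumption rules out
  \<open>k\<close>, unless \<open>x = k\<close>, and then \<open>J + k + y\<close> is itself the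
  base sought.\<close>

lemma completes_exchange:
  assumes "completes (insert h J) x" "completes (insert k J) y" "y \<notin> insert h J"
    and "h \<notin> insert k J" "\<not> completes (insert k J) x"
  shows "completes (insert y J) x"
proof (cases "x = k")
  case True
  have "insert k (insert y J) \<in> \<B>"
    using assms(2) by (simp add: completes_def insert_commute)
  moreover have "k \<notin> insert y J"
    using assms(1,2) True by (auto simp: completes_def)
  ultimately show ?thesis
    using True by (simp add: completes_def)
next
  case False
  have x: "x \<notin> insert h J" "insert x (insert h J) \<in> \<B>"
    using assms(1) by (auto simp: completes_def)
  have y: "insert y (insert k J) \<in> \<B>"
    using assms(2) by (simp add: completes_def)
  have "h \<in> insert x (insert h J) - insert y (insert k J)"
    using assms(3,4) by blast
  then obtain b where b: "b \<in> insert y (insert k J) - insert x (insert h J)"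
      "insert b (insert x (insert h J) - {h}) \<in> \<B>"
    using exchange[OF x(2) y] by blast
  have "insert x (insert h J) - {h} = insert x J"
    using x(1) assms(4) by blast
  then have new: "insert x (insert b J) \<in> \<B>"
    using b(2) by (simp add: insert_commute)
  have "b \<noteq> k"
    using new assms(5) False x(1) by (simp add: completes_def) blast
  then have "b = y" using b(1) by blast
  then show ?thesis
    using new b(1) x(1) by (auto simp: completes_def)
qed

lemma completes_trans:
  assumes "completes H x" "completes H y" "completes K y" "completes K z"
  shows "\<exists>L. completes L x \<and> completes L z"
  using assms
\<comment> \<open>The middle element \<open>y\<close> varies because the last case continues with
  \<open>h\<close> in its place.\<close>
proof (induction "card (H - K)" arbitrary: H K y rule: less_induct)
  case less
  have fin: "finite H" "finite K"
    using less.prems finite_base[of "insert y H"] finite_base[of "insert y K"]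
    by (auto simp: completes_def)
  have y: "y \<notin> H" "y \<notin> K" "insert y H \<in> \<B>" "insert y K \<in> \<B>"
    using less.prems by (auto simp: completes_def)
  show ?case
  proof (cases "H \<subseteq> K")
    case True
    then have "insert y H = insert y K"
      using base_antichain[OF y(3,4)] by blast
    then have "H = K"
      using y(1,2) by (simp add: insert_ident)
    then show ?thesis using less.prems by blast
  next
    case False
    then obtain h where h: "h \<in> H" "h \<notin> K" by blast
    then obtain k where k: "k \<in> K" "k \<notin> H"
        "insert k (insert y H - {h}) \<in> \<B>" "insert h (insert y K - {k}) \<in> \<B>"
      using exchange[OF y(3,4), of h] y by blast
    define J I where "J = H - {h}" and "I = K - {k}"
    have H: "H = insert h J" "h \<notin> J" and K: "K = insert k I" "k \<notin> I"
      using h k by (auto simp: J_def I_def)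
    have neq: "h \<noteq> y" "k \<noteq> y" "h \<noteq> k" using h k y by auto
    have J'y: "completes (insert k J) y" and I'y: "completes (insert h I) y"
      using k y neq h by (auto simp: completes_def J_def I_def insert_Diff_if insert_commute)
    \<comment> \<open>In each of the three cases the difference of the new pair is exactly
      \<open>J - K\<close>.\<close>
    have drop: "card (J - K) < card (H - K)"
      using fin h by (intro psubset_card_mono) (auto simp: J_def)
    show ?thesis
    proof (cases "completes (insert k J) x")
      case True
      have "insert k J - K = J - K" using k by auto
      then show ?thesis
        using less.hyps[OF _ True J'y less.prems(3,4)] drop by simp
    next
      case nx: False
      show ?thesis
      proof (cases "completes (insert h I) z")
        case True
        have "H - insert h I = J - K" using k by (auto simp: J_def I_def)
        then show ?thesis
          using less.hyps[OF _ less.prems(1,2) I'y True] drop by simp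
      next
        case nz: False
        \<comment> \<open>Both replacements fail, so \<open>y\<close> has to come in on either side;
          the second use swaps the roles of \<open>h\<close> and \<open>k\<close>.\<close>
        have "completes (insert y J) x"
          using completes_exchange[of h J x k y] less.prems(1) J'y nx H neq y by auto
        moreover have "completes (insert y I) z"
          using completes_exchange[of k I z h y] less.prems(4) I'y nz K neq y by auto
        moreover have "completes (insert y J) h"
          using y H neq by (auto simp: completes_def insert_commute)
        moreover have "completes (insert y I) h"
          using I'y h neq by (auto simp: completes_def insert_commute I_def)
        moreover have "insert y J - insert y I = J - K"
          using k y by (auto simp: J_def I_def)
        ultimately show ?thesis
          using less.hyps[of "insert y J" "insert y I" h] drop by simp
      qed
    qed
  qed
qed

definition interchangeable :: "'a \<Rightarrow> 'a \<Rightarrow> bool" where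
  "interchangeable x y \<longleftrightarrow> (\<exists>B\<in>\<B>. y \<in> B \<and> B - {y} \<union> {x} \<in> \<B>)"

text \<open>Take \<open>H = B - {y}\<close>. It cannot contain \<open>x\<close>, since then it would
  be a base properly inside \<open>B\<close>. The right-hand side is visibly symmetric.\<close>

lemma interchangeable_iff:
  "interchangeable x y \<longleftrightarrow> (\<exists>H. completes H x \<and> completes H y)"
proof
  assume "interchangeable x y"
  then obtain B where B: "B \<in> \<B>" "y \<in> B" "insert x (B - {y}) \<in> \<B>"
    by (auto simp: interchangeable_def)
  have "x \<notin> B - {y}"
  proof
    assume "x \<in> B - {y}"
    then have "insert x (B - {y}) = B - {y}" by auto
    then have "B - {y} = B"
      using B base_antichain[of "B - {y}" B] by auto
    then show False using B(2) by blast
  qed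
  then have "completes (B - {y}) x \<and> completes (B - {y}) y"
    using B by (simp add: completes_def insert_absorb)
  then show "\<exists>H. completes H x \<and> completes H y" ..
next
  assume "\<exists>H. completes H x \<and> completes H y"
  then obtain H where "x \<notin> H" "insert x H \<in> \<B>" "y \<notin> H" "insert y H \<in> \<B>"
    by (auto simp: completes_def)
  then show "interchangeable x y"
    unfolding interchangeable_def by (intro bexI[of _ "insert y H"]) auto
qed

lemma equiv_interchangeable:
  "equiv (\<Union>\<B>) {(x, y). x \<in> \<Union>\<B> \<and> y \<in> \<Union>\<B> \<and> interchangeable x y}"
proof (rule equivI)
  show "refl_on (\<Union>\<B>) {(x, y). x \<in> \<Union>\<B> \<and> y \<in> \<Union>\<B> \<and> interchangeable x y}"
    by (auto simp: refl_on_def interchangeable_def insert_absorb)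
  show "sym {(x, y). x \<in> \<Union>\<B> \<and> y \<in> \<Union>\<B> \<and> interchangeable x y}"
    unfolding interchangeable_iff by (rule symI) blast
  show "trans {(x, y). x \<in> \<Union>\<B> \<and> y \<in> \<Union>\<B> \<and> interchangeable x y}"
    unfolding interchangeable_iff by (rule transI) (use completes_trans in blast)
qed blast

end

section \<open>Symmetric exchange for bases of a vector space\<close>

context vectorspace
begin

text \<open>Otherwise adding first \<open>b\<close> and then \<open>a\<close> to \<open>E\<close>
  would preserve independence, although \<open>b\<close> depends on
  \<open>insert a E\<close>.\<close>

lemma in_span_exchange:
  assumes E: "E \<subseteq> carrier V" "lin_indpt E" and a: "a \<in> carrier V" and b: "b \<in> carrier V"
    and "b \<notin> span E" "b \<in> span (insert a E)"
  shows "a \<in> span (insert b E)"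
proof (rule ccontr)
  assume na: "a \<notin> span (insert b E)"
  have bE: "insert b E \<subseteq> carrier V" using E b by simp
  have aE: "a \<notin> insert b E" using na in_own_span[OF bE] by blast
  have bnE: "b \<notin> E" using in_own_span[OF E(1)] assms(5) by blast
  have "lin_indpt (insert b E)"
    using lin_dep_iff_in_span[OF E b bnE] assms(5) by simp
  then have "lin_indpt (insert a (insert b E))"
    using lin_dep_iff_in_span[OF bE _ a aE] na by simp
  then have ind: "lin_indpt (insert b (insert a E))" by (simp add: insert_commute)
  then have "lin_indpt (insert a E)" by (rule subset_li_is_li) blast
  then have "lin_dep (insert b (insert a E))"
    using lin_dep_iff_in_span[of "insert a E" b] E a b aE bnE assms(6) by auto
  then show False using ind by contradiction
qed

lemma basis_symmetric_exchange:
  assumes A: "basis A" "finite A" and B: "basis B" "finite B" and a: "a \<in> A - B"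
  shows "\<exists>b\<in>B - A. basis (insert b (A - {a})) \<and> basis (insert a (B - {b}))"
proof -
  have sub: "A \<subseteq> carrier V" "B \<subseteq> carrier V" and ind: "lin_indpt A" "lin_indpt B"
    and gen: "span A = carrier V" "span B = carrier V"
    using A B by (auto simp: basis_def)
  have av: "a \<in> carrier V" using a sub by blast
  define E where "E = A - {a}"
  have E: "E \<subseteq> carrier V" "lin_indpt E" "A = insert a E" "a \<notin> E" "finite E"
    using sub a A subset_li_is_li[OF ind(1)] by (auto simp: E_def)
  have aE: "a \<notin> span E"
    using lin_dep_iff_in_span[OF E(1,2) av E(4)] ind(1) E(3) by simp
  \<comment> \<open>A minimal member \<open>D\<close> is the support of the expansion of
    \<open>a\<close> in \<open>B\<close>. As \<open>a\<close> is not in \<open>span E\<close>, some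
    \<open>b\<close> in \<open>D\<close> is not either, and this \<open>b\<close> serves both
    exchanges.\<close>
  define \<D> where "\<D> = {C. C \<subseteq> B \<and> a \<in> span C}"
  have "finite \<D>" using B(2) by (simp add: \<D>_def)
  moreover have "B \<in> \<D>" using gen av by (simp add: \<D>_def)
  ultimately obtain D where D_in: "D \<in> \<D>" and D_min: "\<forall>C\<in>\<D>. C \<subseteq> D \<longrightarrow> D = C"
    using finite_has_minimal[of \<D>] by blast
  have D: "D \<subseteq> B" "a \<in> span D" using D_in by (simp_all add: \<D>_def)
  have "\<not> D \<subseteq> span E"
    using span_is_subset[OF _ span_is_submodule[OF E(1)], of D] D(2) aE by blast
  then obtain b where b: "b \<in> D" "b \<notin> span E" by blast
  then have bB: "b \<in> B" "b \<in> carrier V" using D sub by auto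
  have bA: "b \<notin> A" using b bB a E in_own_span[OF E(1)] by auto
  have "a \<in> span (insert b E)"
    using in_span_exchange[OF E(1,2) av bB(2) b(2)] gen bB E(3) by simp
  then have 1: "basis (insert b E)"
    using basis_swap[of E a b] E av bB A by simp
  \<comment> \<open>Minimality of \<open>D\<close> makes \<open>b\<close> indispensable for
    \<open>a\<close>, so \<open>b\<close> can be recovered from \<open>a\<close> and the rest of
    \<open>D\<close>.\<close>
  have "D - {b} \<notin> \<D>" using D_min b(1) by blast
  then have "a \<notin> span (D - {b})" using D(1) by (auto simp: \<D>_def)
  moreover have "a \<in> span (insert b (D - {b}))" using D(2) b(1) by (simp add: insert_absorb)
  moreover have "lin_indpt (D - {b})" by (rule subset_li_is_li[OF ind(2)]) (use D in blast)
  ultimately have "b \<in> span (insert a (D - {b}))"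
    using in_span_exchange[of "D - {b}" b a] D sub av bB by auto
  then have "b \<in> span (insert a (B - {b}))"
    using span_is_monotone[of "insert a (D - {b})" "insert a (B - {b})"] D by auto
  then have "basis (insert a (B - {b}))"
    using basis_swap[of "B - {b}" b a] sub av bB B by (auto simp: insert_absorb)
  then show ?thesis using 1 bA bB by (auto simp: E_def)
qed

end

section \<open>Application to minimum cycle bases\<close>

lemma base_exchange_MCB:
  fixes V :: "'v set" and E :: "'v set set"
  assumes G: "finite_simple_graph V E"
  shows "base_exchange {M. MCB V E M}"
proof -
  interpret vs: vectorspace GF2 "cycle_space V E" by (rule vectorspace_cycle_space[OF G])
  have fin: "finite M" if "cycle_basis V E M" for M
  proof (rule finite_subset)
    have "M \<subseteq> carrier (cycle_space V E)" using that by (simp add: vs.basis_def)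
    then show "M \<subseteq> Pow E" by (auto simp: cycle_space_def cycles_def)
    show "finite (Pow E)" using finite_simple_graph_finite_edges[OF G] by simp
  qed
  let ?w = "\<lambda>M :: 'v set set set. \<Sum>B\<in>M. card B"
  \<comment> \<open>Weights are natural numbers, so the equation is written without
    subtraction.\<close>
  have swap: "?w (insert b (M - {a})) + card a = ?w M + card b"
    if "finite M" "a \<in> M" "b \<notin> M" for M a b
    using that sum.remove[of M a card] by simp
  have MCB: "MCB V E M \<longleftrightarrow> cycle_basis V E M \<and> (\<forall>N. cycle_basis V E N \<longrightarrow> ?w M \<le> ?w N)" for M
    by (auto simp: MCB_def is_arg_min_def not_less)
  show ?thesis
  proof
    fix A assume "A \<in> {M. MCB V E M}"
    then show "finite A" using fin MCB by simp
  next
    fix A B a assume "A \<in> {M. MCB V E M}" "B \<in> {M. MCB V E M}" and a: "a \<in> A - B"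
    then have A: "MCB V E A" and B: "MCB V E B" by simp_all
    then have bas: "cycle_basis V E A" "cycle_basis V E B" by (simp_all add: MCB)
    obtain b where b: "b \<in> B - A" and new: "cycle_basis V E (insert b (A - {a}))"
        "cycle_basis V E (insert a (B - {b}))"
      using vs.basis_symmetric_exchange[OF bas(1) fin[OF bas(1)] bas(2) fin[OF bas(2)] a] by blast
    \<comment> \<open>The two changes of weight are opposite, and by minimality neither is negative,
      so both vanish.\<close>
    have "?w (insert b (A - {a})) + card a = ?w A + card b"
      "?w (insert a (B - {b})) + card b = ?w B + card a"
      using swap fin bas a b by auto
    moreover have "?w A \<le> ?w (insert b (A - {a}))" "?w B \<le> ?w (insert a (B - {b}))"
      using A B new by (auto simp: MCB)
    ultimately have "?w (insert b (A - {a})) = ?w A" "?w (insert a (B - {b})) = ?w B" by linarith+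
    then have "MCB V E (insert b (A - {a}))" "MCB V E (insert a (B - {b}))"
      using A B new by (simp_all add: MCB)
    then show "\<exists>b\<in>B - A. insert b (A - {a}) \<in> {M. MCB V E M} \<and>
        insert a (B - {b}) \<in> {M. MCB V E M}"
      using b by blast
  qed
qed

theorem theorem1:
  fixes V :: "'v set" and E :: "'v set set"
  assumes "finite_simple_graph V E"
  shows "equiv (relevant_cycles V E)
    {(C\<^sub>1, C\<^sub>2). C\<^sub>1 \<in> relevant_cycles V E \<and> C\<^sub>2 \<in> relevant_cycles V E \<and>
      pi_interchangeable V E C\<^sub>1 C\<^sub>2}"
proof -
  interpret base_exchange "{M. MCB V E M}" by (rule base_exchange_MCB[OF assms])
  have "pi_interchangeable V E C D \<longleftrightarrow> interchangeable C D" for C D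
    by (auto simp: pi_interchangeable_def interchangeable_def)
  then show ?thesis using equiv_interchangeable by (simp add: relevant_cycles_def)
qed

end
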